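(* Let $n$ be a positive integer and let $\zeta_n$ be any primitive $n$-th root of unity. For all non-negative integers $a, b$, $$z_n(\{1\}^a, 2, \{1\}^b; \zeta_n)+z_n(\{1\}^b,2,\{1\}^a; \zeta_n) = -\frac{1}{n}\binom{n+1}{a+b+3}(1-\zeta_n)^{a+b+2}.$$
   Context: For a positive integer $k$ and a complex number $q$, $[k]_q=1+q+\cdots+q^{k-1}$ (equal to $\frac{1-q^k}{1-q}$ for $q\neq 1$). For a primitive $n$-th root of unity $\zeta_n\in\mathbb{C}$ and an $r$-tuple ${\bf s}=(s_1,\ldots,s_r)$ of positive integers, $$z_n({\bf s};\zeta_n)=z_n(s_1,\ldots,s_r;\zeta_n)=\sum_{1\le k_1<\cdots<k_r\le n-1}\ \prod_{i=1}^r\frac{\zeta_n^{(s_i-1)k_i}}{[k_i]_{\zeta_n}^{s_i}},$$ where an empty sum (the case $n-1<r$) is $0$. The symbol $\{c\}^m$ denotes $m$ consecutive copies of the entry $c$ (nothing if $m=0$), so $(\{1\}^a,2,\{1\}^b)$ is a tuple of length $a+b+1$. *)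

theory Defs
  imports "HOL-Analysis.Analysis"
begin

definition primitive_root_of_unity :: "nat \<Rightarrow> complex \<Rightarrow> bool" where
  "primitive_root_of_unity n \<zeta> \<longleftrightarrow> n > 0 \<and> \<zeta> ^ n = 1 \<and> (\<forall>m. 0 < m \<and> m < n \<longrightarrow> \<zeta> ^ m \<noteq> 1)"

definition q_int :: "nat \<Rightarrow> complex \<Rightarrow> complex" where
  "q_int k q = (\<Sum>j<k. q ^ j)"

(* Integer tuples 1 <= k_1 < ... < k_r <= n - 1, as lists (indexed from 0). *)
definition increasing_tuples :: "nat \<Rightarrow> nat \<Rightarrow> nat list set" where
  "increasing_tuples n r = {ks. length ks = r \<and> sorted_wrt (<) ks \<and> set ks \<subseteq> {1..n - 1}}"

lemma finite_increasing_tuples: "finite (increasing_tuples n r)"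
  by (rule finite_subset[OF _ finite_lists_length_eq[of "{1..n - 1}" r]])
     (auto simp: increasing_tuples_def)

(* Intended for tuples s of positive integers, so that s ! i - 1 does not truncate. *)
(* The multiple harmonic q-series z_n(s; zeta) evaluated at q = zeta. *)
definition mzv_root :: "nat \<Rightarrow> nat list \<Rightarrow> complex \<Rightarrow> complex" where
  "mzv_root n s \<zeta> = (\<Sum>ks\<in>increasing_tuples n (length s).
     \<Prod>i<length s. \<zeta> ^ ((s ! i - 1) * ks ! i) / q_int (ks ! i) \<zeta> ^ (s ! i))"

end

theory Submission
  imports Defs
begin

text \<open>
  Write $x_j = 1/(1-\zeta^j)$ and $\beta_j = \zeta^j/(1-\zeta^j)$. Everything rests on the
  polynomial identity
  \[ \sum_{k=1}^{n-1} \beta_k \prod_{j<k}(A-\zeta^j) \prod_{j>k}(B-\zeta^j)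
     = \sum_{u=1}^{n-1} \beta_u \frac{A^u-1}{A-1} \cdot \frac{B^{n-u}-1}{B-1}. \]
  If $E(A)$ denotes either side, then $(1-\zeta A)E(\zeta A)-(1-A)E(A)$ no longer contains the
  denominators $1-\zeta^k$, and on the left it telescopes to the value on the right. So the two
  sides agree at $A = \zeta, \ldots, \zeta^{n-1}$, while their degree in $A$ is at most $n-2$.
  With $A = 1+s$ and $B = 1+t$, comparing coefficients of $s^a t^b$ gives
  \[ n \sum_k \zeta^k x_k^2\, e_a(x_1,\ldots,x_{k-1})\, e_b(x_{k+1},\ldots,x_{n-1})
     = \sum_u \beta_u \binom{u}{a+1}\binom{n-u}{b+1}. \]
  The sum over $k$ is $z_n(\{1\}^a,2,\{1\}^b;\zeta)/(1-\zeta)^{a+b+2}$. Finally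
  $\beta_u+\beta_{n-u} = -1$, so symmetrising in $a, b$ leaves a binomial convolution.
\<close>

section \<open>A binomial convolution, and polynomials determined at roots of unity\<close>

text \<open>Classify the subsets of {0,...,n} of size a + b + 1 by their element u of rank a + 1:
  there are a elements below u and b above it.\<close>

lemma sum_choose_mult_choose:
  "(\<Sum>u\<le>n. (u choose a) * ((n - u) choose b)) = (n + 1) choose (a + b + 1)"
proof (induction n arbitrary: b)
  case 0
  then show ?case by (cases a; cases b) auto
next
  case (Suc n)
  show ?case
  proof (cases b)
    case 0
    then show ?thesis
      using sum_choose_upper[of a "Suc n"] by simp
  next
    case (Suc b')
    \<comment> \<open>Pascal's rule is applied to the second factor for u at most n; the term u = n
      + 1 vanishes because b > 0.\<close>
    have "(\<Sum>u\<le>Suc n. (u choose a) * ((Suc n - u) choose b))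
        = (\<Sum>u\<le>n. (u choose a) * ((n - u) choose b') + (u choose a) * ((n - u) choose b))"
      using Suc by (auto intro!: sum.cong simp: Suc_diff_le algebra_simps)
    also have "\<dots> = (Suc n + 1) choose (a + b + 1)"
      unfolding sum.distrib Suc.IH using Suc by simp
    finally show ?thesis .
  qed
qed

lemma geometric_sum_mult:
  fixes x :: "'a::comm_ring_1"
  shows "(1 - x) * (\<Sum>i<m. x ^ i) = 1 - x ^ m"
  by (simp add: one_diff_power_eq)

text \<open>The difference would have n - 1 distinct roots and smaller degree. The point 1 is left
  out of the sample because the shift relation, with its factor 1 - A, gives no information
  there.\<close>

lemma poly_eqI_roots_of_unity:
  fixes p r :: "'a::idom poly"
  assumes "inj_on (\<lambda>i. q ^ i) {1..<n}" "degree p < n - 1" "degree r < n - 1"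
    and "\<And>i. 1 \<le> i \<Longrightarrow> i < n \<Longrightarrow> poly p (q ^ i) = poly r (q ^ i)"
  shows "p = r"
proof (rule ccontr)
  assume "p \<noteq> r"
  then have nz: "p - r \<noteq> 0" by simp
  have "(\<lambda>i. q ^ i) ` {1..<n} \<subseteq> {x. poly (p - r) x = 0}"
    using assms(4) by auto
  then have "card ((\<lambda>i. q ^ i) ` {1..<n}) \<le> card {x. poly (p - r) x = 0}"
    using nz by (intro card_mono poly_roots_finite)
  also have "\<dots> \<le> degree (p - r)"
    using nz by (rule card_poly_roots_bound)
  finally have "n - 1 \<le> degree (p - r)"
    using card_image[OF assms(1)] by simp
  then show False using degree_diff_less[OF assms(2,3)] by simp
qed

lemma degree_prod_linear:
  fixes c :: "'b \<Rightarrow> 'a::idom"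
  shows "degree (\<Prod>j\<in>S. [:- c j, 1:]) = (if finite S then card S else 0)"
  by (auto simp: degree_prod_eq_sum_degree)

text \<open>Both sides are monic of degree n - 1 and vanish at q, ..., q^(n-1). Removing the common
  leading term brings the degree below n - 1, so that these points suffice.\<close>

lemma prod_linear_roots_of_unity:
  fixes q X :: "'a::idom"
  assumes "n > 0" and inj: "inj_on (\<lambda>i. q ^ i) {..<n}" and "q ^ n = 1"
  shows "(\<Prod>j\<in>{1..<n}. X - q ^ j) = (\<Sum>i<n. X ^ i)"
proof -
  define p where "p = (\<Prod>j\<in>{1..<n}. [:- (q ^ j), 1:])"
  define r where "r = (\<Sum>i<n - 1. monom (1::'a) i)"
  have deg: "degree p = n - 1"
    unfolding p_def by (subst degree_prod_linear) simp
  have lead: "coeff p (n - 1) = 1"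
  proof -
    have "lead_coeff p = 1" unfolding p_def lead_coeff_prod by simp
    with deg show ?thesis by simp
  qed
  have sum_n: "(\<Sum>i<n. X ^ i) = X ^ (n - 1) + (\<Sum>i<n - 1. X ^ i)" for X :: 'a
    using \<open>n > 0\<close> by (cases n) simp_all
  have "p - monom 1 (n - 1) = r"
  proof (cases "n = 1")
    case True
    then show ?thesis by (simp add: p_def r_def)
  next
    case False
    then have n: "n - 1 > 0" using \<open>n > 0\<close> by simp
    show ?thesis
    proof (rule poly_eqI_roots_of_unity)
      show "inj_on (\<lambda>i. q ^ i) {1..<n}"
        using inj by (rule inj_on_subset) auto
      have "degree (p - monom 1 (n - 1)) \<le> n - 1"
        by (rule degree_diff_le) (simp_all add: deg degree_monom_le)
      moreover have "coeff (p - monom 1 (n - 1)) (n - 1) = 0"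
        using lead by simp
      ultimately show "degree (p - monom 1 (n - 1)) < n - 1"
        using n by (metis degree_0 le_neq_implies_less leading_coeff_0_iff)
      show "degree r < n - 1"
        unfolding r_def using n
        by (intro le_less_trans[OF degree_sum_le[of _ _ "n - 2"]])
           (auto simp: degree_monom_eq)
    next
      fix i assume i: "1 \<le> i" "i < n"
      have "1 - q ^ i \<noteq> 0"
        using inj_onD[OF inj, of 0 i] i by auto
      moreover have "(1 - q ^ i) * (\<Sum>m<n. (q ^ i) ^ m) = 0"
        unfolding geometric_sum_mult using \<open>q ^ n = 1\<close>
        by (metis diff_self mult.commute power_mult power_one)
      ultimately have "(\<Sum>m<n. (q ^ i) ^ m) = 0" by simp
      moreover have "poly p (q ^ i) = 0"
        using i by (auto simp: p_def poly_prod)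
      ultimately show "poly (p - monom 1 (n - 1)) (q ^ i) = poly r (q ^ i)"
        by (simp add: sum_n r_def poly_sum poly_monom neg_eq_iff_add_eq_0)
    qed
  qed
  then have "poly p X = X ^ (n - 1) + poly r X"
    by (metis add.commute diff_add_cancel poly_add poly_monom mult_1)
  then show ?thesis
    by (simp add: sum_n r_def p_def poly_prod poly_sum poly_monom)
qed

section \<open>The q-shift, two telescoping sums and the polynomial identity\<close>

text \<open>Replacing A by qA turns the roots q, ..., q^(k-1) into 1, ..., q^(k-2). Both products,
  once multiplied by their linear factors, are therefore multiples of \<open>\<alpha>\<close>, and
  their difference contains the factor 1 - q^k that \<beta> needs. The condition on \<beta> is
  written without division so that it also makes sense over a polynomial ring.\<close>

lemma prod_linear_q_shift:
  fixes q A \<beta> :: "'a::comm_ring_1"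
  assumes "k \<ge> 1" and "\<beta> * (1 - q ^ k) = q ^ k"
  shows "\<beta> * ((1 - q * A) * (\<Prod>j\<in>{1..<k}. q * A - q ^ j) - (1 - A) * (\<Prod>j\<in>{1..<k}. A - q ^ j))
    = q * A * (\<Prod>j\<in>{1..<k}. q * A - q ^ j)"
proof -
  obtain m where k: "k = Suc m" using assms(1) by (cases k) auto
  define \<alpha> where "\<alpha> = (\<Prod>j<m. A - q ^ j)"
  have ivl: "(\<Prod>j\<in>{1..<k}. f j) = (\<Prod>j<m. f (Suc j))" for f :: "nat \<Rightarrow> 'a"
    unfolding k lessThan_atLeast0 One_nat_def prod.atLeast_Suc_lessThan_Suc_shift comp_def ..
  have 1: "(\<Prod>j\<in>{1..<k}. q * A - q ^ j) = q ^ m * \<alpha>"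
    unfolding ivl by (simp add: \<alpha>_def right_diff_distrib[symmetric] prod.distrib)
  have "(A - 1) * (\<Prod>j\<in>{1..<k}. A - q ^ j) = (\<Prod>j<Suc m. A - q ^ j)"
    unfolding ivl prod.lessThan_Suc_shift by simp
  then have 2: "(A - 1) * (\<Prod>j\<in>{1..<k}. A - q ^ j) = \<alpha> * (A - q ^ m)"
    by (simp add: \<alpha>_def)
  have "(1 - q * A) * (\<Prod>j\<in>{1..<k}. q * A - q ^ j) - (1 - A) * (\<Prod>j\<in>{1..<k}. A - q ^ j)
    = (1 - q * A) * (q ^ m * \<alpha>) + \<alpha> * (A - q ^ m)"
    unfolding 1 2[symmetric] by (simp add: algebra_simps)
  also have "\<dots> = (1 - q ^ k) * (A * \<alpha>)"
    by (simp add: k algebra_simps)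
  finally have "\<beta> * ((1 - q * A) * (\<Prod>j\<in>{1..<k}. q * A - q ^ j) - (1 - A) * (\<Prod>j\<in>{1..<k}. A - q ^ j))
    = (\<beta> * (1 - q ^ k)) * (A * \<alpha>)"
    by (simp add: mult.assoc)
  then show ?thesis
    unfolding assms(2) 1 by (simp add: k algebra_simps)
qed

text \<open>Write X - B as (X - y k) - (B - y k): each summand becomes a difference of consecutive
  mixed products \<open>T\<close>, in which the factors with B are exchanged one at a time for
  factors with X.\<close>

lemma telescope_prod_linear:
  fixes y :: "nat \<Rightarrow> 'a::comm_ring_1"
  assumes "n > 0"
  shows "(X - B) * (\<Sum>k\<in>{1..<n}. (\<Prod>j\<in>{1..<k}. X - y j) * (\<Prod>j\<in>{k<..<n}. B - y j))
    = (\<Prod>j\<in>{1..<n}. X - y j) - (\<Prod>j\<in>{1..<n}. B - y j)"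
proof -
  define T where "T k = (\<Prod>j\<in>{1..<k}. X - y j) * (\<Prod>j\<in>{k..<n}. B - y j)" for k
  have "(X - B) * ((\<Prod>j\<in>{1..<k}. X - y j) * (\<Prod>j\<in>{k<..<n}. B - y j)) = T (Suc k) - T k"
    if "k \<in> {1..<n}" for k
  proof -
    have "{k..<n} = insert k {k<..<n}" "{Suc k..<n} = {k<..<n}" using that by auto
    moreover have "{1..<Suc k} = insert k {1..<k}" using that by auto
    ultimately show ?thesis
      unfolding T_def by (simp add: algebra_simps)
  qed
  then have "(X - B) * (\<Sum>k\<in>{1..<n}. (\<Prod>j\<in>{1..<k}. X - y j) * (\<Prod>j\<in>{k<..<n}. B - y j))
    = (\<Sum>k\<in>{1..<n}. T (Suc k) - T k)"
    by (simp add: sum_distrib_left)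
  also have "\<dots> = T n - T 1"
    using assms by (intro sum_Suc_diff') simp
  finally show ?thesis by (simp add: T_def)
qed

text \<open>Multiplying a geometric sum in B by B lengthens it by one term, up to a 1. So each
  summand telescopes up to a remainder X^u, and these remainders build the geometric sum in
  X.\<close>

lemma telescope_geometric:
  fixes X B :: "'a::comm_ring_1"
  assumes "n > 0"
  shows "(X - B) * (\<Sum>u\<in>{1..<n}. X ^ u * (\<Sum>i<n - u. B ^ i)) = X * ((\<Sum>i<n. X ^ i) - (\<Sum>i<n. B ^ i))"
proof -
  define T where "T u = X ^ u * (\<Sum>i<n + 1 - u. B ^ i)" for u
  have "(X - B) * (X ^ u * (\<Sum>i<n - u. B ^ i)) = (T (Suc u) - T u) + X ^ u" if "u \<in> {1..<n}" for u
  proof -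
    have "n + 1 - u = Suc (n - u)" using that by (simp add: Suc_diff_le)
    then have "(\<Sum>i<n + 1 - u. B ^ i) = 1 + B * (\<Sum>i<n - u. B ^ i)"
      by (simp only: sum.lessThan_Suc_shift) (simp add: sum_distrib_left)
    then show ?thesis by (simp add: T_def algebra_simps)
  qed
  then have "(X - B) * (\<Sum>u\<in>{1..<n}. X ^ u * (\<Sum>i<n - u. B ^ i))
    = (\<Sum>u\<in>{1..<n}. T (Suc u) - T u) + (\<Sum>u\<in>{1..<n}. X ^ u)"
    by (simp add: sum_distrib_left sum.distrib)
  also have "(\<Sum>u\<in>{1..<n}. T (Suc u) - T u) = T n - T 1"
    using assms by (intro sum_Suc_diff') simp
  \<comment> \<open>The upper end of the telescope supplies the term u = n that the remainders
    lack.\<close>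
  also have "T n = X ^ n" by (simp add: T_def)
  also have "X ^ n - T 1 + (\<Sum>u\<in>{1..<n}. X ^ u) = (\<Sum>u\<in>{1..<Suc n}. X ^ u) - T 1"
    using assms by simp
  also have "(\<Sum>u\<in>{1..<Suc n}. X ^ u) = X * (\<Sum>i<n. X ^ i)"
    unfolding lessThan_atLeast0 One_nat_def sum.atLeast_Suc_lessThan_Suc_shift comp_def
    by (simp add: sum_distrib_left)
  also have "T 1 = X * (\<Sum>i<n. B ^ i)" by (simp add: T_def)
  finally show ?thesis by (simp add: algebra_simps)
qed

text \<open>Only A is treated as a variable. B stays off the powers of q so that Y - B can be
  cancelled at every step of the chain 1, q, q^2, ... of values of A.\<close>

lemma sum_prod_linear_eq_sum_geometric:
  fixes q A B :: "'a::idom" and \<beta> :: "nat \<Rightarrow> 'a"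
  assumes "n > 0" and inj: "inj_on (\<lambda>i. q ^ i) {..<n}" and "q ^ n = 1"
    and \<beta>: "\<And>k. 1 \<le> k \<Longrightarrow> k < n \<Longrightarrow> \<beta> k * (1 - q ^ k) = q ^ k"
    and B: "\<And>i. B \<noteq> q ^ i"
  shows "(\<Sum>k\<in>{1..<n}. \<beta> k * (\<Prod>j\<in>{1..<k}. A - q ^ j) * (\<Prod>j\<in>{k<..<n}. B - q ^ j))
    = (\<Sum>u\<in>{1..<n}. \<beta> u * (\<Sum>i<u. A ^ i) * (\<Sum>i<n - u. B ^ i))"
proof -
  define a where "a k X = (\<Prod>j\<in>{1..<k}. X - q ^ j)" for k X
  define b where "b k = (\<Prod>j\<in>{k<..<n}. B - q ^ j)" for k
  define L where "L X = (\<Sum>k\<in>{1..<n}. \<beta> k * a k X * b k)" for X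
  define R where "R X = (\<Sum>u\<in>{1..<n}. \<beta> u * (\<Sum>i<u. X ^ i) * (\<Sum>i<n - u. B ^ i))" for X
  have L_shift: "(1 - q * X) * L (q * X) - (1 - X) * L X = q * X * (\<Sum>k\<in>{1..<n}. a k (q * X) * b k)" for X
  proof -
    have "(1 - q * X) * L (q * X) - (1 - X) * L X
      = (\<Sum>k\<in>{1..<n}. \<beta> k * ((1 - q * X) * a k (q * X) - (1 - X) * a k X) * b k)"
      by (simp add: L_def sum_distrib_left sum_subtractf[symmetric] algebra_simps)
    also have "\<dots> = (\<Sum>k\<in>{1..<n}. q * X * a k (q * X) * b k)"
      unfolding a_def by (intro sum.cong refl arg_cong2[where f = times] prod_linear_q_shift) (auto simp: \<beta>)
    finally show ?thesis by (simp add: sum_distrib_left mult.assoc)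
  qed
  have R_shift: "(1 - q * X) * R (q * X) - (1 - X) * R X
      = (\<Sum>u\<in>{1..<n}. (q * X) ^ u * (\<Sum>i<n - u. B ^ i))" for X
  proof -
    \<comment> \<open>The factor 1 - Y closes the geometric sum in Y. In the difference at qX and X
      only \<beta> u (1 - q^u) X^u survives, and this is (qX)^u.\<close>
    have *: "(1 - Y) * R Y = (\<Sum>u\<in>{1..<n}. \<beta> u * (1 - Y ^ u) * (\<Sum>i<n - u. B ^ i))" for Y
      unfolding R_def geometric_sum_mult[symmetric]
      by (subst sum_distrib_left, intro sum.cong refl) (simp only: ac_simps)
    have "(1 - q * X) * R (q * X) - (1 - X) * R X
      = (\<Sum>u\<in>{1..<n}. (\<beta> u * (1 - q ^ u)) * X ^ u * (\<Sum>i<n - u. B ^ i))"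
      unfolding * sum_subtractf[symmetric]
      by (intro sum.cong refl) (simp add: power_mult_distrib algebra_simps)
    also have "\<dots> = (\<Sum>u\<in>{1..<n}. (q * X) ^ u * (\<Sum>i<n - u. B ^ i))"
      by (intro sum.cong refl) (simp add: \<beta> power_mult_distrib)
    finally show ?thesis .
  qed
  have shift: "(1 - Y) * L Y = (1 - Y) * R Y" if "(1 - X) * L X = (1 - X) * R X" "Y = q * X" "Y \<noteq> B" for X Y
  proof -
    \<comment> \<open>The two telescoping lemmas meet here: the product over the nontrivial roots of
      unity is the geometric sum, so both shift terms agree after multiplication by Y - B.\<close>
    have "(Y - B) * (Y * (\<Sum>k\<in>{1..<n}. a k Y * b k)) = Y * ((\<Prod>j\<in>{1..<n}. Y - q ^ j) - (\<Prod>j\<in>{1..<n}. B - q ^ j))"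
      unfolding a_def b_def using telescope_prod_linear[OF \<open>n > 0\<close>, of Y B "\<lambda>j. q ^ j"]
      by (simp only: mult.left_commute)
    also have "\<dots> = (Y - B) * (\<Sum>u\<in>{1..<n}. Y ^ u * (\<Sum>i<n - u. B ^ i))"
      unfolding prod_linear_roots_of_unity[OF assms(1-3)] telescope_geometric[OF \<open>n > 0\<close>] ..
    finally have "Y * (\<Sum>k\<in>{1..<n}. a k Y * b k) = (\<Sum>u\<in>{1..<n}. Y ^ u * (\<Sum>i<n - u. B ^ i))"
      using that(3) by simp
    then have "(1 - Y) * L Y - (1 - X) * L X = (1 - Y) * R Y - (1 - X) * R X"
      unfolding that(2) L_shift R_shift .
    then show ?thesis by (metis diff_add_cancel that(1))
  qed
  \<comment> \<open>The base case is trivial because the factor \<open>1 - A\<close> vanishes at \<open>A = 1\<close>.\<close>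
  have roots: "(1 - q ^ i) * L (q ^ i) = (1 - q ^ i) * R (q ^ i)" for i
  proof (induction i)
    case (Suc i)
    show ?case by (rule shift[OF Suc]) (use B in \<open>auto simp del: power_Suc simp: power_Suc[symmetric] dest: sym\<close>)
  qed simp
  define p where "p = (\<Sum>k\<in>{1..<n}. smult (\<beta> k * b k) (\<Prod>j\<in>{1..<k}. [:- (q ^ j), 1:]))"
  define r where "r = (\<Sum>u\<in>{1..<n}. smult (\<beta> u * (\<Sum>i<n - u. B ^ i)) (\<Sum>i<u. monom 1 i))"
  have p: "poly p X = L X" for X
    by (simp add: p_def L_def a_def poly_sum poly_prod mult_ac)
  have r: "poly r X = R X" for X
    by (simp add: r_def R_def poly_sum poly_monom mult_ac)
  have "L A = R A"
  \<comment> \<open>For n = 1 both sums are empty, and no degree can lie below n - 1 = 0. Otherwise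
    the summands have degrees k - 1 and at most u - 1, hence at most n - 2.\<close>
  proof (cases "n = 1")
    case False
    then have n: "n - 2 < n - 1" using \<open>n > 0\<close> by simp
    have "p = r"
    proof (rule poly_eqI_roots_of_unity)
      show "inj_on (\<lambda>i. q ^ i) {1..<n}"
        using inj by (rule inj_on_subset) auto
      have "degree p \<le> n - 2"
        unfolding p_def
        by (intro degree_sum_le order_trans[OF degree_smult_le]) (auto simp: degree_prod_linear)
      then show "degree p < n - 1" using n by simp
      have "degree r \<le> n - 2"
        unfolding r_def
        by (intro degree_sum_le order_trans[OF degree_smult_le] order_trans[OF degree_monom_le]) auto
      then show "degree r < n - 1" using n by simp
    next
      fix i assume i: "1 \<le> i" "i < n"
      then have "1 - q ^ i \<noteq> 0"
        using inj_onD[OF inj, of 0 i] by auto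
      then show "poly p (q ^ i) = poly r (q ^ i)"
        using roots[of i] by (simp add: p r)
    qed
    then show ?thesis by (metis p r)
  qed (simp add: L_def R_def)
  then show ?thesis by (simp add: L_def R_def a_def b_def)
qed

section \<open>Elementary symmetric sums as polynomial coefficients\<close>

text \<open>Indexing by subsets matches the expansion of a product of binomials.\<close>

definition elem_sym :: "('b \<Rightarrow> 'a::comm_ring_1) \<Rightarrow> 'b set \<Rightarrow> nat \<Rightarrow> 'a" where
  "elem_sym f S m = (\<Sum>X | X \<subseteq> S \<and> card X = m. \<Prod>j\<in>X. f j)"

lemma coeff_prod_linear:
  fixes f :: "'b \<Rightarrow> 'a::comm_ring_1"
  assumes "finite S"
  shows "coeff (\<Prod>j\<in>S. [:1, f j:]) m = elem_sym f S m"
proof -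
  have "(\<Prod>j\<in>S. [:1, f j:]) = (\<Prod>j\<in>S. monom (f j) 1 + 1)"
    by (intro prod.cong refl) (simp add: monom_altdef one_pCons)
  also have "\<dots> = (\<Sum>X\<in>Pow S. monom (\<Prod>j\<in>X. f j) (card X))"
  proof -
    have "(\<Prod>j\<in>X. monom (f j) 1) = monom (\<Prod>j\<in>X. f j) (card X)" for X
      by (induction X rule: infinite_finite_induct) (simp_all add: mult_monom one_pCons monom_0)
    then show ?thesis unfolding prod_add[OF assms] by simp
  qed
  finally have "coeff (\<Prod>j\<in>S. [:1, f j:]) m = (\<Sum>X\<in>Pow S. if card X = m then \<Prod>j\<in>X. f j else 0)"
    by (simp add: coeff_sum)
  also have "\<dots> = elem_sym f S m"
    unfolding elem_sym_def using assms
    by (intro sum.mono_neutral_cong_right) auto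
  finally show ?thesis .
qed

text \<open>Pull c j out of each factor c j + t, leaving 1 + t / c j; this is where the reciprocals
  1 / (1 - q^j) come from.\<close>

lemma coeff_prod_one_plus_linear:
  fixes c :: "'b \<Rightarrow> 'a::field"
  assumes "finite S" and "\<And>j. j \<in> S \<Longrightarrow> c j \<noteq> 0"
  shows "coeff (\<Prod>j\<in>S. [:c j, 1:]) m = (\<Prod>j\<in>S. c j) * elem_sym (\<lambda>j. 1 / c j) S m"
proof -
  have "(\<Prod>j\<in>S. [:c j, 1:]) = (\<Prod>j\<in>S. smult (c j) [:1, 1 / c j:])"
    using assms(2) by (intro prod.cong) auto
  also have "\<dots> = smult (\<Prod>j\<in>S. c j) (\<Prod>j\<in>S. [:1, 1 / c j:])"
    by (rule prod_smult)
  finally show ?thesis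
    by (simp add: coeff_prod_linear[OF assms(1)])
qed

text \<open>The sum is ((1 + t)^u - 1) / t, which shifts the binomial coefficients of (1 + t)^u by
  one.\<close>

lemma coeff_geometric_sum_linear:
  "coeff (\<Sum>i<u. [:1, 1::'a::comm_ring_1:] ^ i) m = of_nat (u choose Suc m)"
proof (induction u)
  case (Suc u)
  have "coeff ([:1, 1::'a:] ^ u) m = of_nat (u choose m)"
  proof (cases "m \<le> u")
    case True
    then show ?thesis by (simp add: coeff_linear_poly_power)
  next
    case False
    have "degree ([:1, 1::'a:] ^ u) \<le> u"
      using degree_power_le[of "[:1, 1::'a:]" u] by simp
    with False show ?thesis by (simp add: coeff_eq_0 binomial_eq_0)
  qed
  with Suc show ?case by (simp add: add.commute)
qed simp

text \<open>Coefficients of the polynomial identity are taken one variable at a time, first in t and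
  then in s. The constant terms pulled out of the products combine to n.\<close>

lemma sum_elem_sym_eq_sum_choose:
  fixes q :: "'a::field_char_0" and \<beta> :: "nat \<Rightarrow> 'a"
  assumes "n > 0" and inj: "inj_on (\<lambda>i. q ^ i) {..<n}" and "q ^ n = 1"
    and \<beta>: "\<And>k. 1 \<le> k \<Longrightarrow> k < n \<Longrightarrow> \<beta> k * (1 - q ^ k) = q ^ k"
  defines "x \<equiv> \<lambda>j. 1 / (1 - q ^ j)"
  shows "of_nat n * (\<Sum>k\<in>{1..<n}. q ^ k * x k ^ 2 * elem_sym x {1..<k} l * elem_sym x {k<..<n} m)
    = (\<Sum>u\<in>{1..<n}. \<beta> u * of_nat (u choose Suc l) * of_nat ((n - u) choose Suc m))"
proof -
  have nz: "1 - q ^ j \<noteq> 0" if "1 \<le> j" "j < n" for j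
    using inj_onD[OF inj, of 0 j] that by auto
  \<comment> \<open>This is the coefficient of t^m, with t the formal variable and s still an
    arbitrary scalar.\<close>
  have outer: "(\<Sum>k\<in>{1..<n}. \<beta> k * (\<Prod>j\<in>{1..<k}. 1 + s - q ^ j) * ((\<Prod>j\<in>{k<..<n}. 1 - q ^ j) * elem_sym x {k<..<n} m))
    = (\<Sum>u\<in>{1..<n}. \<beta> u * (\<Sum>i<u. (1 + s) ^ i) * of_nat ((n - u) choose Suc m))" for s
  proof -
    \<comment> \<open>Working over the polynomial ring makes \<open>B = 1 + t\<close> differ from every power of \<open>q\<close>.\<close>
    have "inj_on (\<lambda>i. [:q:] ^ i) {..<n}"
      using inj by (auto simp: inj_on_def poly_const_pow)
    moreover have "[:q:] ^ n = 1"
      by (simp add: poly_const_pow \<open>q ^ n = 1\<close> one_pCons)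
    moreover have "[:\<beta> k:] * (1 - [:q:] ^ k) = [:q:] ^ k" if "1 \<le> k" "k < n" for k
      using \<beta>[OF that] by (simp add: poly_const_pow one_pCons mult.commute)
    moreover have "[:1, 1:] \<noteq> [:q:] ^ i" for i
      by (simp add: poly_const_pow)
    ultimately have "(\<Sum>k\<in>{1..<n}. [:\<beta> k:] * (\<Prod>j\<in>{1..<k}. [:1 + s:] - [:q:] ^ j) * (\<Prod>j\<in>{k<..<n}. [:1, 1:] - [:q:] ^ j))
      = (\<Sum>u\<in>{1..<n}. [:\<beta> u:] * (\<Sum>i<u. [:1 + s:] ^ i) * (\<Sum>i<n - u. [:1, 1:] ^ i))"
      using \<open>n > 0\<close> by (intro sum_prod_linear_eq_sum_geometric) auto
    moreover have "(\<Prod>j\<in>S. [:1 + s:] - [:q:] ^ j) = [:\<Prod>j\<in>S. 1 + s - q ^ j:]" for S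
      by (induction S rule: infinite_finite_induct) (simp_all add: poly_const_pow one_pCons)
    moreover have "(\<Sum>i<u. [:1 + s:] ^ i) = [:\<Sum>i<u. (1 + s) ^ i:]" for u
      by (induction u) (simp_all add: poly_const_pow)
    moreover have "[:1, 1:] - [:q:] ^ j = [:1 - q ^ j, 1:]" for j
      by (simp add: poly_const_pow)
    moreover have const: "[:c:] * [:d:] * p = smult (c * d) p" for c d :: 'a and p
      by (simp add: mult_ac)
    ultimately have "(\<Sum>k\<in>{1..<n}. smult (\<beta> k * (\<Prod>j\<in>{1..<k}. 1 + s - q ^ j)) (\<Prod>j\<in>{k<..<n}. [:1 - q ^ j, 1:]))
      = (\<Sum>u\<in>{1..<n}. smult (\<beta> u * (\<Sum>i<u. (1 + s) ^ i)) (\<Sum>i<n - u. [:1, 1:] ^ i))"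
      by (simp only: const)
    then have "coeff (\<Sum>k\<in>{1..<n}. smult (\<beta> k * (\<Prod>j\<in>{1..<k}. 1 + s - q ^ j)) (\<Prod>j\<in>{k<..<n}. [:1 - q ^ j, 1:])) m
      = coeff (\<Sum>u\<in>{1..<n}. smult (\<beta> u * (\<Sum>i<u. (1 + s) ^ i)) (\<Sum>i<n - u. [:1, 1:] ^ i)) m"
      by (rule arg_cong)
    moreover have "coeff (\<Prod>j\<in>{k<..<n}. [:1 - q ^ j, 1:]) m = (\<Prod>j\<in>{k<..<n}. 1 - q ^ j) * elem_sym x {k<..<n} m" if "k \<in> {1..<n}" for k
      unfolding x_def by (intro coeff_prod_one_plus_linear nz) (use that in auto)
    ultimately show ?thesis
      by (simp add: coeff_sum[where A = "{Suc 0..<n}"] coeff_geometric_sum_linear)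
  qed
  have "(\<Sum>k\<in>{1..<n}. smult (\<beta> k * ((\<Prod>j\<in>{k<..<n}. 1 - q ^ j) * elem_sym x {k<..<n} m)) (\<Prod>j\<in>{1..<k}. [:1 - q ^ j, 1:]))
    = (\<Sum>u\<in>{1..<n}. smult (\<beta> u * of_nat ((n - u) choose Suc m)) (\<Sum>i<u. [:1, 1:] ^ i))"
    \<comment> \<open>In characteristic 0, equality for all scalars s is equality of polynomials in
      s.\<close>
    unfolding poly_eq_poly_eq_iff[symmetric]
    using outer by (simp add: fun_eq_iff poly_sum poly_prod algebra_simps)
  then have "coeff (\<Sum>k\<in>{1..<n}. smult (\<beta> k * ((\<Prod>j\<in>{k<..<n}. 1 - q ^ j) * elem_sym x {k<..<n} m)) (\<Prod>j\<in>{1..<k}. [:1 - q ^ j, 1:])) l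
    = coeff (\<Sum>u\<in>{1..<n}. smult (\<beta> u * of_nat ((n - u) choose Suc m)) (\<Sum>i<u. [:1, 1:] ^ i)) l"
    by (rule arg_cong)
  moreover have "coeff (\<Prod>j\<in>{1..<k}. [:1 - q ^ j, 1:]) l = (\<Prod>j\<in>{1..<k}. 1 - q ^ j) * elem_sym x {1..<k} l" if "k \<in> {1..<n}" for k
    unfolding x_def by (intro coeff_prod_one_plus_linear nz) (use that in auto)
  ultimately have weighted: "(\<Sum>k\<in>{1..<n}. \<beta> k * ((\<Prod>j\<in>{k<..<n}. 1 - q ^ j) * elem_sym x {k<..<n} m) * ((\<Prod>j\<in>{1..<k}. 1 - q ^ j) * elem_sym x {1..<k} l))
    = (\<Sum>u\<in>{1..<n}. \<beta> u * of_nat (u choose Suc l) * of_nat ((n - u) choose Suc m))"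
    by (simp add: coeff_sum[where A = "{Suc 0..<n}"] coeff_geometric_sum_linear mult_ac)
  have "\<beta> k * ((\<Prod>j\<in>{k<..<n}. 1 - q ^ j) * elem_sym x {k<..<n} m) * ((\<Prod>j\<in>{1..<k}. 1 - q ^ j) * elem_sym x {1..<k} l)
    = of_nat n * (q ^ k * x k ^ 2 * elem_sym x {1..<k} l * elem_sym x {k<..<n} m)" if "k \<in> {1..<n}" for k
  proof -
    \<comment> \<open>Setting X = 1 in the factorisation gives n. The products over j < k and j > k
      miss only 1 - q^k, which comes from \<beta> k = q^k (x k)^2 (1 - q^k).\<close>
    have "of_nat n = (\<Prod>j\<in>{1..<n}. 1 - q ^ j)"
      using prod_linear_roots_of_unity[OF assms(1-3), of 1] by simp
    also have "{1..<n} = insert k ({1..<k} \<union> {k<..<n})" using that by auto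
    also have "(\<Prod>j\<in>\<dots>. 1 - q ^ j) = (1 - q ^ k) * ((\<Prod>j\<in>{1..<k}. 1 - q ^ j) * (\<Prod>j\<in>{k<..<n}. 1 - q ^ j))"
      by (subst prod.insert, simp, simp, subst prod.union_disjoint) auto
    finally have prod: "of_nat n = (1 - q ^ k) * ((\<Prod>j\<in>{1..<k}. 1 - q ^ j) * (\<Prod>j\<in>{k<..<n}. 1 - q ^ j))" .
    have "x k * (1 - q ^ k) = 1"
      using nz that by (simp add: x_def)
    moreover have "q ^ k * x k ^ 2 * (1 - q ^ k) = \<beta> k * (x k * (1 - q ^ k)) ^ 2"
    proof -
      have "q ^ k = \<beta> k * (1 - q ^ k)" using \<beta>[of k] that by simp
      then have "q ^ k * (x k ^ 2 * (1 - q ^ k)) = \<beta> k * (1 - q ^ k) * (x k ^ 2 * (1 - q ^ k))"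
        by (rule arg_cong)
      then show ?thesis
        by (simp only: power_mult_distrib power2_eq_square mult_ac)
    qed
    ultimately have "\<beta> k = q ^ k * x k ^ 2 * (1 - q ^ k)"
      by simp
    then show ?thesis
      unfolding prod by (simp only: mult_ac)
  qed
  then have "of_nat n * (\<Sum>k\<in>{1..<n}. q ^ k * x k ^ 2 * elem_sym x {1..<k} l * elem_sym x {k<..<n} m)
    = (\<Sum>k\<in>{1..<n}. \<beta> k * ((\<Prod>j\<in>{k<..<n}. 1 - q ^ j) * elem_sym x {k<..<n} m) * ((\<Prod>j\<in>{1..<k}. 1 - q ^ j) * elem_sym x {1..<k} l))"
    unfolding sum_distrib_left by (intro sum.cong refl) (rule sym)
  also note weighted
  finally show ?thesis .
qed

section \<open>From increasing tuples to elementary symmetric sums\<close>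

lemma bij_betw_set_sorted_lists:
  fixes S :: "'a::linorder set"
  assumes "finite S"
  shows "bij_betw set {ks. length ks = m \<and> sorted_wrt (<) ks \<and> set ks \<subseteq> S} {X. X \<subseteq> S \<and> card X = m}"
proof (rule bij_betw_byWitness[where f' = sorted_list_of_set])
  show "\<forall>ks\<in>{ks. length ks = m \<and> sorted_wrt (<) ks \<and> set ks \<subseteq> S}. sorted_list_of_set (set ks) = ks"
    by (auto intro: strict_sorted_equal)
  show "\<forall>X\<in>{X. X \<subseteq> S \<and> card X = m}. set (sorted_list_of_set X) = X"
    using finite_subset[OF _ assms] by auto
  show "set ` {ks. length ks = m \<and> sorted_wrt (<) ks \<and> set ks \<subseteq> S} \<subseteq> {X. X \<subseteq> S \<and> card X = m}"
    by (auto simp: strict_sorted_iff distinct_card)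
  show "sorted_list_of_set ` {X. X \<subseteq> S \<and> card X = m} \<subseteq> {ks. length ks = m \<and> sorted_wrt (<) ks \<and> set ks \<subseteq> S}"
    using finite_subset[OF _ assms] by (auto simp: strict_sorted_iff)
qed

lemma sum_prod_list_sorted_lists:
  fixes S :: "'b::linorder set" and f :: "'b \<Rightarrow> 'a::comm_ring_1"
  assumes "finite S"
  shows "(\<Sum>ks | length ks = m \<and> sorted_wrt (<) ks \<and> set ks \<subseteq> S. \<Prod>k\<leftarrow>ks. f k) = elem_sym f S m"
  unfolding elem_sym_def sum.reindex_bij_betw[OF bij_betw_set_sorted_lists[OF assms], symmetric]
  by (intro sum.cong refl) (auto simp: strict_sorted_iff prod.distinct_set_conv_list)

text \<open>A product over a list, unlike one over indices, splits along concatenation.\<close>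

lemma prod_nth_eq_prod_list_zip:
  assumes "length xs = length ys"
  shows "(\<Prod>i<length xs. f (xs ! i) (ys ! i)) = (\<Prod>(x, y)\<leftarrow>zip xs ys. f x y)"
  unfolding prod.list_conv_set_nth lessThan_atLeast0 using assms by simp

text \<open>Cut each tuple at the entry k that carries the exponent 2. The entries before and after
  k range independently below and above k; their exponent is 1, so they contribute no power of
  \<zeta> in the numerator.\<close>

lemma mzv_root_replicate_2_replicate:
  fixes \<zeta> :: complex
  shows "mzv_root n (replicate a 1 @ [2] @ replicate b 1) \<zeta>
    = (\<Sum>k\<in>{1..<n}. \<zeta> ^ k / q_int k \<zeta> ^ 2 * elem_sym (\<lambda>j. 1 / q_int j \<zeta>) {1..<k} a
        * elem_sym (\<lambda>j. 1 / q_int j \<zeta>) {k<..<n} b)"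
proof -
  let ?s = "replicate a 1 @ [2] @ replicate b (1::nat)"
  let ?f = "\<lambda>j. 1 / q_int j \<zeta>"
  let ?L = "\<lambda>S m. {ks :: nat list. length ks = m \<and> sorted_wrt (<) ks \<and> set ks \<subseteq> S}"
  let ?g = "\<lambda>(k, xs, ys). xs @ [k] @ ys"
  have summand: "(\<Prod>i<length ?s. \<zeta> ^ ((?s ! i - 1) * (xs @ [k] @ ys) ! i) / q_int ((xs @ [k] @ ys) ! i) \<zeta> ^ (?s ! i))
      = \<zeta> ^ k / q_int k \<zeta> ^ 2 * (\<Prod>j\<leftarrow>xs. ?f j) * (\<Prod>j\<leftarrow>ys. ?f j)"
    if "length xs = a" "length ys = b" for xs ys k
  proof -
    have "(\<Prod>i<length ?s. \<zeta> ^ ((?s ! i - 1) * (xs @ [k] @ ys) ! i) / q_int ((xs @ [k] @ ys) ! i) \<zeta> ^ (?s ! i))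
      = (\<Prod>(c, j)\<leftarrow>zip ?s (xs @ [k] @ ys). \<zeta> ^ ((c - 1) * j) / q_int j \<zeta> ^ c)"
      by (rule prod_nth_eq_prod_list_zip) (simp add: that)
    also have "zip ?s (xs @ [k] @ ys) = map (Pair 1) xs @ [(2, k)] @ map (Pair 1) ys"
      using that by (simp add: zip_replicate1 flip: that)
    finally show ?thesis
      by (simp add: comp_def)
  qed
  have "bij_betw ?g (SIGMA k:{1..<n}. ?L {1..<k} a \<times> ?L {k<..<n} b) (increasing_tuples n (length ?s))"
  \<comment> \<open>Positions count from 0, so the exponent 2 sits at index a.\<close>
  proof (rule bij_betw_byWitness[where f' = "\<lambda>ks. (ks ! a, take a ks, drop (Suc a) ks)"])
    show "\<forall>ks\<in>increasing_tuples n (length ?s). ?g (ks ! a, take a ks, drop (Suc a) ks) = ks"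
      by (auto simp: increasing_tuples_def id_take_nth_drop[symmetric])
    show "?g ` (SIGMA k:{1..<n}. ?L {1..<k} a \<times> ?L {k<..<n} b) \<subseteq> increasing_tuples n (length ?s)"
      by (fastforce simp: increasing_tuples_def sorted_wrt_append subset_iff)
    show "(\<lambda>ks. (ks ! a, take a ks, drop (Suc a) ks)) ` increasing_tuples n (length ?s)
      \<subseteq> (SIGMA k:{1..<n}. ?L {1..<k} a \<times> ?L {k<..<n} b)"
    proof (rule image_subsetI)
      fix ks assume ks: "ks \<in> increasing_tuples n (length ?s)"
      then have "a < length ks" by (simp add: increasing_tuples_def)
      then obtain xs k ys where "ks = xs @ k # ys" "length xs = a"
        by (metis id_take_nth_drop length_take min.absorb2 less_imp_le)
      with ks show "(ks ! a, take a ks, drop (Suc a) ks) \<in> (SIGMA k:{1..<n}. ?L {1..<k} a \<times> ?L {k<..<n} b)"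
        by (fastforce simp: increasing_tuples_def sorted_wrt_append)
    qed
  qed auto
  then have "mzv_root n ?s \<zeta> = (\<Sum>(k, xs, ys)\<in>(SIGMA k:{1..<n}. ?L {1..<k} a \<times> ?L {k<..<n} b).
      \<zeta> ^ k / q_int k \<zeta> ^ 2 * (\<Prod>j\<leftarrow>xs. ?f j) * (\<Prod>j\<leftarrow>ys. ?f j))"
    unfolding mzv_root_def
  proof (subst sum.reindex_bij_betw[symmetric], assumption, intro sum.cong refl)
    fix p assume "p \<in> (SIGMA k:{1..<n}. ?L {1..<k} a \<times> ?L {k<..<n} b)"
    then obtain k xs ys where "p = (k, xs, ys)" "length xs = a" "length ys = b"
      by (cases p) auto
    then show "(\<Prod>i<length ?s. \<zeta> ^ ((?s ! i - 1) * ?g p ! i) / q_int (?g p ! i) \<zeta> ^ (?s ! i))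
      = (case p of (k, xs, ys) \<Rightarrow> \<zeta> ^ k / q_int k \<zeta> ^ 2 * (\<Prod>j\<leftarrow>xs. ?f j) * (\<Prod>j\<leftarrow>ys. ?f j))"
      by (simp only: prod.case summand)
  qed
  also have "\<dots> = (\<Sum>k\<in>{1..<n}. \<Sum>xs\<in>?L {1..<k} a. \<Sum>ys\<in>?L {k<..<n} b.
      \<zeta> ^ k / q_int k \<zeta> ^ 2 * (\<Prod>j\<leftarrow>xs. ?f j) * (\<Prod>j\<leftarrow>ys. ?f j))"
  proof -
    have "finite (?L S m)" if "finite S" for S m
      by (rule finite_subset[OF _ finite_lists_length_eq[OF that, of m]]) auto
    then show ?thesis
      by (simp add: sum.Sigma sum.cartesian_product case_prod_unfold)
  qed
  also have "\<dots> = (\<Sum>k\<in>{1..<n}. \<zeta> ^ k / q_int k \<zeta> ^ 2 * elem_sym ?f {1..<k} a * elem_sym ?f {k<..<n} b)"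
    by (simp add: sum_prod_list_sorted_lists[symmetric] sum_distrib_left sum_distrib_right sum_product mult_ac)
  finally show ?thesis .
qed

section \<open>Rescaling by powers of 1 - \<zeta> and symmetrising in a and b\<close>

lemma elem_sym_scale:
  "elem_sym (\<lambda>j. c * f j) S m = c ^ m * elem_sym f S m"
  unfolding elem_sym_def sum_distrib_left
  by (intro sum.cong refl) (auto simp: prod.distrib)

theorem theorem1p2:
  fixes n a b :: nat and \<zeta> :: complex
  assumes "n > 0" and "primitive_root_of_unity n \<zeta>"
  shows "mzv_root n (replicate a 1 @ [2] @ replicate b 1) \<zeta> + mzv_root n (replicate b 1 @ [2] @ replicate a 1) \<zeta>
    = - (1 / of_nat n) * of_nat ((n + 1) choose (a + b + 3)) * (1 - \<zeta>) ^ (a + b + 2)"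
proof -
  have root: "\<zeta> ^ n = 1" and prim: "\<And>m. 0 < m \<Longrightarrow> m < n \<Longrightarrow> \<zeta> ^ m \<noteq> 1"
    using assms(2) by (auto simp: primitive_root_of_unity_def)
  have "\<zeta> \<noteq> 0" using root \<open>n > 0\<close> by (auto simp: power_0_left)
  have "\<zeta> ^ i \<noteq> \<zeta> ^ j" if "i < j" "j < n" for i j
  proof
    assume "\<zeta> ^ i = \<zeta> ^ j"
    also have "\<zeta> ^ j = \<zeta> ^ i * \<zeta> ^ (j - i)"
      using that by (simp flip: power_add)
    finally show False using prim[of "j - i"] that \<open>\<zeta> \<noteq> 0\<close> by simp
  qed
  then have inj: "inj_on (\<lambda>i. \<zeta> ^ i) {..<n}"
    by (intro linorder_inj_onI') auto
  define \<beta> where "\<beta> k = \<zeta> ^ k / (1 - \<zeta> ^ k)" for k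
  define x where "x j = 1 / (1 - \<zeta> ^ j)" for j
  have \<beta>: "\<beta> k * (1 - \<zeta> ^ k) = \<zeta> ^ k" if "1 \<le> k" "k < n" for k
    using prim[of k] that by (simp add: \<beta>_def)
  \<comment> \<open>The a + b entries of exponent 1 and the entry of exponent 2 together contribute
    a + b + 2 factors 1 - \<zeta>. For n = 1 the closed form of \<open>q_int\<close> fails, as
    \<zeta> = 1, but both sums are empty.\<close>
  have z: "of_nat n * mzv_root n (replicate a 1 @ [2] @ replicate b 1) \<zeta>
    = (1 - \<zeta>) ^ (a + b + 2) * (\<Sum>u\<in>{1..<n}. \<beta> u * of_nat ((u choose Suc a) * ((n - u) choose Suc b)))" for a b
  proof (cases "n = 1")
    case False
    then have "\<zeta> \<noteq> 1" using prim[of 1] \<open>n > 0\<close> by auto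
    \<comment> \<open>This holds for every k: where \<zeta>^k = 1, both sides are 0 by the
      convention 1 / 0 = 0. So it can be rewritten under the binder in
      \<open>elem_sym\<close>.\<close>
    then have q_int: "1 / q_int k \<zeta> = (1 - \<zeta>) * x k" for k
      by (simp add: q_int_def x_def sum_gp_strict)
    have "\<zeta> ^ k / q_int k \<zeta> ^ 2 = (1 - \<zeta>) ^ 2 * (\<zeta> ^ k * x k ^ 2)" for k
      using arg_cong[OF q_int[of k], of "\<lambda>y. \<zeta> ^ k * y ^ 2"] by (simp add: power_mult_distrib power_divide)
    then have "mzv_root n (replicate a 1 @ [2] @ replicate b 1) \<zeta>
      = (1 - \<zeta>) ^ (a + b + 2) * (\<Sum>k\<in>{1..<n}. \<zeta> ^ k * x k ^ 2 * elem_sym x {1..<k} a * elem_sym x {k<..<n} b)"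
      unfolding mzv_root_replicate_2_replicate q_int elem_sym_scale
      by (simp add: sum_distrib_left power_add power2_eq_square mult_ac)
    moreover have "of_nat n * (\<Sum>k\<in>{1..<n}. \<zeta> ^ k * x k ^ 2 * elem_sym x {1..<k} a * elem_sym x {k<..<n} b)
      = (\<Sum>u\<in>{1..<n}. \<beta> u * of_nat ((u choose Suc a) * ((n - u) choose Suc b)))"
      using sum_elem_sym_eq_sum_choose[OF \<open>n > 0\<close> inj root \<beta>, of a b]
      unfolding x_def[abs_def] of_nat_mult by (simp only: mult.assoc)
    ultimately show ?thesis
      by (simp only: mult.left_commute[of "of_nat n"])
  next
    case True
    then show ?thesis unfolding mzv_root_replicate_2_replicate by simp
  qed
  \<comment> \<open>Since \<zeta>^(n-u) is the inverse of \<zeta>^u, the second term equals 1 /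
    (\<zeta>^u - 1).\<close>
  have \<beta>_sum: "\<beta> u + \<beta> (n - u) = - 1" if "u \<in> {1..<n}" for u
  proof -
    have "\<zeta> ^ u * \<zeta> ^ (n - u) = 1"
      using that root by (simp flip: power_add)
    moreover have "\<zeta> ^ u \<noteq> 1" "\<zeta> ^ (n - u) \<noteq> 1"
      using prim that by auto
    ultimately show ?thesis
      by (simp add: \<beta>_def divide_simps) (simp add: algebra_simps)
  qed
  \<comment> \<open>The substitution of n - u for u gives the sum for the swapped tuple the same
    binomial weights.\<close>
  have reflect: "(\<Sum>u\<in>{1..<n}. \<beta> u * of_nat ((u choose Suc b) * ((n - u) choose Suc a)))
    = (\<Sum>u\<in>{1..<n}. \<beta> (n - u) * of_nat ((u choose Suc a) * ((n - u) choose Suc b)))"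
    by (rule sum.reindex_bij_witness[of _ "\<lambda>u. n - u" "\<lambda>u. n - u"]) auto
  \<comment> \<open>The added end terms u = 0 and u = n vanish, since each contains a binomial
    coefficient with upper entry 0 and positive lower entry.\<close>
  have "(\<Sum>u\<in>{1..<n}. (u choose Suc a) * ((n - u) choose Suc b)) = (\<Sum>u\<le>n. (u choose Suc a) * ((n - u) choose Suc b))"
    by (rule sum.mono_neutral_left) (auto simp: not_less_eq_eq le_Suc_eq)
  then have vandermonde: "(\<Sum>u\<in>{1..<n}. (u choose Suc a) * ((n - u) choose Suc b)) = (n + 1) choose (a + b + 3)"
    by (simp add: sum_choose_mult_choose numeral_3_eq_3)
  have "of_nat n * (mzv_root n (replicate a 1 @ [2] @ replicate b 1) \<zeta> + mzv_root n (replicate b 1 @ [2] @ replicate a 1) \<zeta>)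
    = (1 - \<zeta>) ^ (a + b + 2) * (\<Sum>u\<in>{1..<n}. (\<beta> u + \<beta> (n - u)) * of_nat ((u choose Suc a) * ((n - u) choose Suc b)))"
    unfolding distrib_left z reflect by (simp add: distrib_left distrib_right sum.distrib add.commute)
  also have "\<dots> = - ((1 - \<zeta>) ^ (a + b + 2) * of_nat ((n + 1) choose (a + b + 3)))"
  proof -
    have "(\<Sum>u\<in>{1..<n}. (\<beta> u + \<beta> (n - u)) * of_nat ((u choose Suc a) * ((n - u) choose Suc b)))
      = (\<Sum>u\<in>{1..<n}. - of_nat ((u choose Suc a) * ((n - u) choose Suc b)))"
      by (intro sum.cong refl) (simp only: \<beta>_sum mult_minus1)
    also have "\<dots> = - of_nat ((n + 1) choose (a + b + 3))"
      unfolding sum_negf of_nat_sum[symmetric] vandermonde ..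
    finally show ?thesis by simp
  qed
  finally show ?thesis
    using \<open>n > 0\<close> by (simp add: field_simps)
qed

end
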